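(* For all $\phi,\chi\in\mathcal{L}_\blacktriangle$: if $\phi\vdash\chi$ is proved in the calculus $\mathbb{S}(\mathbf{K}^\blacktriangle_\mathbf{FDE})$ (i.e., there is a closed tree whose root is $\{w_0:\phi;\mathfrak{t},\ w_0:\chi;\overline{\mathfrak{t}}\}$), then $\phi\vdash\chi$ is valid.
   Context: Semantics. Formulas of $\mathcal{L}_\blacktriangle$: $\phi::=p\mid\neg\phi\mid\phi\wedge\phi\mid\phi\vee\phi\mid\blacktriangle\phi$, $p$ in a countable set $\mathsf{Var}$. A frame is $\langle W,R\rangle$, $W\neq\varnothing$, $R\subseteq W^2$; a model is $\langle W,R,v^+,v^-\rangle$ with independent $v^+,v^-:\mathsf{Var}\to 2^W$. $w\vDash^+p$ iff $w\in v^+(p)$; $w\vDash^-p$ iff $w\in v^-(p)$; $\neg$ swaps $\vDash^+$ and $\vDash^-$; $\wedge$: true iff both true, false iff some false; $\vee$: true iff some true, false iff both false. $w_0\vDash^+\blacktriangle\phi$ iff for all $R$-successors $w_1,w_2$ of $w_0$, ($w_1\vDash^+\phi\Rightarrow w_2\vDash^+\phi$) and ($w_1\vDash^-\phi\Rightarrow w_2\vDash^-\phi$), and every $R$-successor $w_1$ has $w_1\vDash^+\phi$ or $w_1\vDash^-\phi$. $w_0\vDash^-\blacktriangle\phi$ iff there are successors $w_1,w_2$ of $w_0$ with ($w_1\vDash^+\phi$, $w_2\nvDash^+\phi$) or ($w_1\vDash^-\phi$, $w_2\nvDash^-\phi$) or ($w_1\vDash^+\phi$, $w_2\vDash^-\phi$).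 $\phi\vdash\chi$ is valid iff in every model at every state, $\vDash^+\phi$ implies $\vDash^+\chi$. Calculus. Fix a countable set of state-labels and value-labels $\{\mathfrak{t},\mathfrak{f},\overline{\mathfrak{t}},\overline{\mathfrak{f}}\}$ (read: true, false, not-true, not-false). A labelled formula is $w:\phi;\mathfrak{v}$. Conventions: $\overline{\overline{\mathfrak{t}}}=\mathfrak{t}$, $\overline{\overline{\mathfrak{f}}}=\mathfrak{f}$; $\mathfrak{t}^\neg=\mathfrak{f}$, $\mathfrak{f}^\neg=\mathfrak{t}$, $\overline{\mathfrak{t}}^\neg=\overline{\mathfrak{f}}$, $\overline{\mathfrak{f}}^\neg=\overline{\mathfrak{t}}$; $w:\phi;\mathfrak{v}_1;\mathfrak{v}_2$ abbreviates the two labelled formulas $w:\phi;\mathfrak{v}_1$ and $w:\phi;\mathfrak{v}_2$. A proof is a downward-branching tree whose nodes are sets of labelled formulas and relational atoms $w\mathsf{R}w'$; a branch may be extended by the rules below (premises above $\Rightarrow$, conclusions after; $\{i,j\}=\{1,2\}$; $w_k,w_{k_1},w_{k_2}$ fresh on the branch): $\neg$: $w:\neg\phi;\mathfrak{t}\Rightarrow w:\phi;\mathfrak{f}$; $w:\neg\phi;\mathfrak{f}\Rightarrow w:\phi;\mathfrak{t}$; $w:\neg\phi;\overline{\mathfrak{t}}\Rightarrow w:\phi;\overline{\mathfrak{f}}$; $w:\neg\phi;\overline{\mathfrak{f}}\Rightarrow w:\phi;\overline{\mathfrak{t}}$. $\wedge$: $w:\phi_1\wedge\phi_2;\mathfrak{t}\Rightarrow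 w:\phi_1;\mathfrak{t}$ and $w:\phi_2;\mathfrak{t}$; $w:\phi_1\wedge\phi_2;\mathfrak{f}$, $w:\phi_i;\overline{\mathfrak{f}}\Rightarrow w:\phi_j;\mathfrak{f}$; $w:\phi_1\wedge\phi_2;\overline{\mathfrak{t}}$, $w:\phi_i;\mathfrak{t}\Rightarrow w:\phi_j;\overline{\mathfrak{t}}$; $w:\phi_1\wedge\phi_2;\overline{\mathfrak{f}}\Rightarrow w:\phi_1;\overline{\mathfrak{f}}$ and $w:\phi_2;\overline{\mathfrak{f}}$. $\vee$: $w:\phi_1\vee\phi_2;\mathfrak{t}$, $w:\phi_i;\overline{\mathfrak{t}}\Rightarrow w:\phi_j;\mathfrak{t}$; $w:\phi_1\vee\phi_2;\mathfrak{f}\Rightarrow w:\phi_1;\mathfrak{f}$ and $w:\phi_2;\mathfrak{f}$; $w:\phi_1\vee\phi_2;\overline{\mathfrak{t}}\Rightarrow w:\phi_1;\overline{\mathfrak{t}}$ and $w:\phi_2;\overline{\mathfrak{t}}$; $w:\phi_1\vee\phi_2;\overline{\mathfrak{f}}$, $w:\phi_i;\mathfrak{f}\Rightarrow w:\phi_j;\overline{\mathfrak{f}}$. Cut: with no premises, split the branch into $w:\phi;\mathfrak{v}\mid w:\phi;\overline{\mathfrak{v}}$, provided $\phi$ is a subformula of a formula on the branch and $w$ occurs on the branch. $\blacktriangle_T$: $w_i:\blacktriangle\phi;\mathfrak{t};\overline{\mathfrak{f}}$, $w_i\mathsf{R}w_j$, $w_j:\phi;\mathfrak{v}\Rightarrow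 w_j:\phi;\overline{\mathfrak{v}}^\neg$. $\blacktriangle'_T$: $w_i:\blacktriangle\phi;\mathfrak{t};\overline{\mathfrak{f}}$, $w_i\mathsf{R}w_{j_1}$, $w_i\mathsf{R}w_{j_2}$, $w_{j_1}:\phi;\mathfrak{v};\overline{\mathfrak{v}}^\neg\Rightarrow w_{j_2}:\phi;\mathfrak{v};\overline{\mathfrak{v}}^\neg$. $\blacktriangle_F$: $w_i:\blacktriangle\phi;\mathfrak{f};\overline{\mathfrak{t}}\Rightarrow$ add $w_i\mathsf{R}w_{k_1}$, $w_i\mathsf{R}w_{k_2}$, then split into $\{w_{k_1}:\phi;\mathfrak{t},\ w_{k_2}:\phi;\overline{\mathfrak{t}}\}\mid\{w_{k_1}:\phi;\mathfrak{f},\ w_{k_2}:\phi;\overline{\mathfrak{f}}\}$. $\blacktriangle_B$: $w_i:\blacktriangle\phi;\mathfrak{t};\mathfrak{f}$, $w_i\mathsf{R}w_j\Rightarrow w_j:\phi;\mathfrak{t};\mathfrak{f}$. $\blacktriangle^+_B$: $w_i:\blacktriangle\phi;\mathfrak{t};\mathfrak{f}\Rightarrow w_i\mathsf{R}w_k$, $w_k:\phi;\mathfrak{t};\mathfrak{f}$. $\blacktriangle_N$: $w_i:\blacktriangle\phi;\overline{\mathfrak{t}};\overline{\mathfrak{f}}$, $w_i\mathsf{R}w_j\Rightarrow w_j:\phi;\overline{\mathfrak{t}};\overline{\mathfrak{f}}$. $\blacktriangle^+_N$: $w_i:\blacktriangle\phi;\overline{\mathfrak{t}};\overline{\mathfrak{f}}\Rightarrow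 w_i\mathsf{R}w_k$, $w_k:\phi;\overline{\mathfrak{t}};\overline{\mathfrak{f}}$. A branch is closed iff it contains $w:\phi;\mathfrak{v}$ and $w:\phi;\overline{\mathfrak{v}}$ for some $w,\phi,\mathfrak{v}$; a tree is closed iff all its branches are closed. $\phi\vdash\chi$ is proved iff there is a closed tree with root $\{w_0:\phi;\mathfrak{t},\ w_0:\chi;\overline{\mathfrak{t}}\}$. *)

theory Defs
  imports Main "HOL-Library.Countable"
begin

section \<open>Language and semantics\<close>

datatype 'p fm =
    Var 'p
  | Neg "'p fm"
  | Conj "'p fm" "'p fm"
  | Disj "'p fm" "'p fm"
  | Tri "'p fm"

primrec subformulas :: "'p fm \<Rightarrow> 'p fm set" where
  "subformulas (Var p) = {Var p}"
| "subformulas (Neg \<phi>) = insert (Neg \<phi>) (subformulas \<phi>)"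
| "subformulas (Conj \<phi> \<psi>) = insert (Conj \<phi> \<psi>) (subformulas \<phi> \<union> subformulas \<psi>)"
| "subformulas (Disj \<phi> \<psi>) = insert (Disj \<phi> \<psi>) (subformulas \<phi> \<union> subformulas \<psi>)"
| "subformulas (Tri \<phi>) = insert (Tri \<phi>) (subformulas \<phi>)"

record ('p, 'w) model =
  worlds :: "'w set"
  acc :: "('w \<times> 'w) set"
  val_pos :: "'p \<Rightarrow> 'w set"
  val_neg :: "'p \<Rightarrow> 'w set"

definition is_model :: "('p, 'w) model \<Rightarrow> bool" where
  "is_model M \<longleftrightarrow> worlds M \<noteq> {} \<and> acc M \<subseteq> worlds M \<times> worlds M \<and>
     (\<forall>p. val_pos M p \<subseteq> worlds M) \<and> (\<forall>p. val_neg M p \<subseteq> worlds M)"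

fun sat_pos :: "('p, 'w) model \<Rightarrow> 'w \<Rightarrow> 'p fm \<Rightarrow> bool"
and sat_neg :: "('p, 'w) model \<Rightarrow> 'w \<Rightarrow> 'p fm \<Rightarrow> bool" where
  "sat_pos M w (Var p) \<longleftrightarrow> w \<in> val_pos M p"
| "sat_neg M w (Var p) \<longleftrightarrow> w \<in> val_neg M p"
| "sat_pos M w (Neg \<phi>) \<longleftrightarrow> sat_neg M w \<phi>"
| "sat_neg M w (Neg \<phi>) \<longleftrightarrow> sat_pos M w \<phi>"
| "sat_pos M w (Conj \<phi> \<psi>) \<longleftrightarrow> sat_pos M w \<phi> \<and> sat_pos M w \<psi>"
| "sat_neg M w (Conj \<phi> \<psi>) \<longleftrightarrow> sat_neg M w \<phi> \<or> sat_neg M w \<psi>"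
| "sat_pos M w (Disj \<phi> \<psi>) \<longleftrightarrow> sat_pos M w \<phi> \<or> sat_pos M w \<psi>"
| "sat_neg M w (Disj \<phi> \<psi>) \<longleftrightarrow> sat_neg M w \<phi> \<and> sat_neg M w \<psi>"
| "sat_pos M w (Tri \<phi>) \<longleftrightarrow>
     (\<forall>w1 w2. (w, w1) \<in> acc M \<longrightarrow> (w, w2) \<in> acc M \<longrightarrow>
        (sat_pos M w1 \<phi> \<longrightarrow> sat_pos M w2 \<phi>) \<and> (sat_neg M w1 \<phi> \<longrightarrow> sat_neg M w2 \<phi>)) \<and>
     (\<forall>w1. (w, w1) \<in> acc M \<longrightarrow> sat_pos M w1 \<phi> \<or> sat_neg M w1 \<phi>)"
| "sat_neg M w (Tri \<phi>) \<longleftrightarrow>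
     (\<exists>w1 w2. (w, w1) \<in> acc M \<and> (w, w2) \<in> acc M \<and>
        ((sat_pos M w1 \<phi> \<and> \<not> sat_pos M w2 \<phi>) \<or>
         (sat_neg M w1 \<phi> \<and> \<not> sat_neg M w2 \<phi>) \<or>
         (sat_pos M w1 \<phi> \<and> sat_neg M w2 \<phi>)))"

text \<open>
  The type argument only fixes the type from which the states are drawn; validity over all
  models is obtained by leaving that type a variable.
\<close>

definition valid :: "'w itself \<Rightarrow> 'p fm \<Rightarrow> 'p fm \<Rightarrow> bool" where
  "valid (_ :: 'w itself) \<phi> \<chi> \<longleftrightarrow>
     (\<forall>M :: ('p, 'w) model. is_model M \<longrightarrow>
        (\<forall>w \<in> worlds M. sat_pos M w \<phi> \<longrightarrow> sat_pos M w \<chi>))"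


section \<open>Calculus\<close>

text \<open>True, false, not-true, not-false.\<close>

datatype vlabel = TT | FF | NT | NF

fun bar :: "vlabel \<Rightarrow> vlabel" where
  "bar TT = NT" | "bar NT = TT" | "bar FF = NF" | "bar NF = FF"

fun vneg :: "vlabel \<Rightarrow> vlabel" where
  "vneg TT = FF" | "vneg FF = TT" | "vneg NT = NF" | "vneg NF = NT"

type_synonym state_label = nat

datatype 'p item =
    LF state_label "'p fm" vlabel
  | Rel state_label state_label

primrec item_labels :: "'p item \<Rightarrow> state_label set" where
  "item_labels (LF w \<phi> v) = {w}"
| "item_labels (Rel w w') = {w, w'}"

definition labels :: "'p item set \<Rightarrow> state_label set" where
  "labels B = (\<Union>x \<in> B. item_labels x)"

text \<open>
  \<open>expands B Cs\<close>: a branch on which exactly the items in \<open>B\<close> occur may be extended by one rule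
  application, splitting into one new node for each set in \<open>Cs\<close>.
  In \<open>Tri_F\<close> the two fresh labels are distinct (with equal labels both alternatives would
  close immediately), and the two relational atoms added before the split are repeated in both
  alternatives.
\<close>

inductive expands :: "'p item set \<Rightarrow> 'p item set list \<Rightarrow> bool" where
  Neg_T: "LF w (Neg \<phi>) TT \<in> B \<Longrightarrow> expands B [{LF w \<phi> FF}]"
| Neg_F: "LF w (Neg \<phi>) FF \<in> B \<Longrightarrow> expands B [{LF w \<phi> TT}]"
| Neg_NT: "LF w (Neg \<phi>) NT \<in> B \<Longrightarrow> expands B [{LF w \<phi> NF}]"
| Neg_NF: "LF w (Neg \<phi>) NF \<in> B \<Longrightarrow> expands B [{LF w \<phi> NT}]"

| Conj_T: "LF w (Conj \<phi>1 \<phi>2) TT \<in> B \<Longrightarrow> expands B [{LF w \<phi>1 TT, LF w \<phi>2 TT}]"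
| Conj_F1: "{LF w (Conj \<phi>1 \<phi>2) FF, LF w \<phi>1 NF} \<subseteq> B \<Longrightarrow> expands B [{LF w \<phi>2 FF}]"
| Conj_F2: "{LF w (Conj \<phi>1 \<phi>2) FF, LF w \<phi>2 NF} \<subseteq> B \<Longrightarrow> expands B [{LF w \<phi>1 FF}]"
| Conj_NT1: "{LF w (Conj \<phi>1 \<phi>2) NT, LF w \<phi>1 TT} \<subseteq> B \<Longrightarrow> expands B [{LF w \<phi>2 NT}]"
| Conj_NT2: "{LF w (Conj \<phi>1 \<phi>2) NT, LF w \<phi>2 TT} \<subseteq> B \<Longrightarrow> expands B [{LF w \<phi>1 NT}]"
| Conj_NF: "LF w (Conj \<phi>1 \<phi>2) NF \<in> B \<Longrightarrow> expands B [{LF w \<phi>1 NF, LF w \<phi>2 NF}]"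

| Disj_T1: "{LF w (Disj \<phi>1 \<phi>2) TT, LF w \<phi>1 NT} \<subseteq> B \<Longrightarrow> expands B [{LF w \<phi>2 TT}]"
| Disj_T2: "{LF w (Disj \<phi>1 \<phi>2) TT, LF w \<phi>2 NT} \<subseteq> B \<Longrightarrow> expands B [{LF w \<phi>1 TT}]"
| Disj_F: "LF w (Disj \<phi>1 \<phi>2) FF \<in> B \<Longrightarrow> expands B [{LF w \<phi>1 FF, LF w \<phi>2 FF}]"
| Disj_NT: "LF w (Disj \<phi>1 \<phi>2) NT \<in> B \<Longrightarrow> expands B [{LF w \<phi>1 NT, LF w \<phi>2 NT}]"
| Disj_NF1: "{LF w (Disj \<phi>1 \<phi>2) NF, LF w \<phi>1 FF} \<subseteq> B \<Longrightarrow> expands B [{LF w \<phi>2 NF}]"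
| Disj_NF2: "{LF w (Disj \<phi>1 \<phi>2) NF, LF w \<phi>2 FF} \<subseteq> B \<Longrightarrow> expands B [{LF w \<phi>1 NF}]"

| Cut: "LF u \<psi> v' \<in> B \<Longrightarrow> \<phi> \<in> subformulas \<psi> \<Longrightarrow> w \<in> labels B \<Longrightarrow>
    expands B [{LF w \<phi> v}, {LF w \<phi> (bar v)}]"

| Tri_T: "{LF w (Tri \<phi>) TT, LF w (Tri \<phi>) NF, Rel w u, LF u \<phi> v} \<subseteq> B \<Longrightarrow>
    expands B [{LF u \<phi> (vneg (bar v))}]"
| Tri_T': "{LF w (Tri \<phi>) TT, LF w (Tri \<phi>) NF, Rel w u1, Rel w u2,
      LF u1 \<phi> v, LF u1 \<phi> (vneg (bar v))} \<subseteq> B \<Longrightarrow>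
    expands B [{LF u2 \<phi> v, LF u2 \<phi> (vneg (bar v))}]"
| Tri_F: "{LF w (Tri \<phi>) FF, LF w (Tri \<phi>) NT} \<subseteq> B \<Longrightarrow>
    k1 \<notin> labels B \<Longrightarrow> k2 \<notin> labels B \<Longrightarrow> k1 \<noteq> k2 \<Longrightarrow>
    expands B [{Rel w k1, Rel w k2, LF k1 \<phi> TT, LF k2 \<phi> NT},
               {Rel w k1, Rel w k2, LF k1 \<phi> FF, LF k2 \<phi> NF}]"
| Tri_B: "{LF w (Tri \<phi>) TT, LF w (Tri \<phi>) FF, Rel w u} \<subseteq> B \<Longrightarrow>
    expands B [{LF u \<phi> TT, LF u \<phi> FF}]"
| Tri_B_plus: "{LF w (Tri \<phi>) TT, LF w (Tri \<phi>) FF} \<subseteq> B \<Longrightarrow> k \<notin> labels B \<Longrightarrow>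
    expands B [{Rel w k, LF k \<phi> TT, LF k \<phi> FF}]"
| Tri_N: "{LF w (Tri \<phi>) NT, LF w (Tri \<phi>) NF, Rel w u} \<subseteq> B \<Longrightarrow>
    expands B [{LF u \<phi> NT, LF u \<phi> NF}]"
| Tri_N_plus: "{LF w (Tri \<phi>) NT, LF w (Tri \<phi>) NF} \<subseteq> B \<Longrightarrow> k \<notin> labels B \<Longrightarrow>
    expands B [{Rel w k, LF k \<phi> NT, LF k \<phi> NF}]"

text \<open>A node carries only the items added at that node.\<close>

datatype 'p tree = Node (root: "'p item set") (children: "'p tree list")

text \<open>
  \<open>tree_from A t\<close>: \<open>t\<close> is built by the rules, where \<open>A\<close> collects the items on the nodes
  strictly above \<open>t\<close>.
\<close>

fun tree_from :: "'p item set \<Rightarrow> 'p tree \<Rightarrow> bool" where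
  "tree_from A (Node N ts) \<longleftrightarrow>
     ts = [] \<or> (expands (A \<union> N) (map root ts) \<and> (\<forall>t \<in> set ts. tree_from (A \<union> N) t))"

definition proof_tree :: "'p tree \<Rightarrow> bool" where
  "proof_tree t \<longleftrightarrow> tree_from {} t"

fun branches :: "'p tree \<Rightarrow> 'p item set list set" where
  "branches (Node N ts) =
     (if ts = [] then {[N]} else (\<Union>t \<in> set ts. (#) N ` branches t))"

definition closed_branch :: "'p item set list \<Rightarrow> bool" where
  "closed_branch b \<longleftrightarrow>
     (\<exists>w \<phi> v. LF w \<phi> v \<in> \<Union>(set b) \<and> LF w \<phi> (bar v) \<in> \<Union>(set b))"

definition closed_tree :: "'p tree \<Rightarrow> bool" where
  "closed_tree t \<longleftrightarrow> (\<forall>b \<in> branches t. closed_branch b)"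

definition proved :: "'p fm \<Rightarrow> 'p fm \<Rightarrow> bool" where
  "proved \<phi> \<chi> \<longleftrightarrow>
     (\<exists>t. proof_tree t \<and> root t = {LF 0 \<phi> TT, LF 0 \<chi> NT} \<and> closed_tree t)"

end

theory Submission
  imports Defs
begin

text \<open>
  Interpret the state labels of a branch as states of a model. Every rule preserves the property
  that some branch has an interpretation making all its items true: if \<open>\<phi>\<close> takes different
  values at successors of \<open>w\<close>, then \<open>Tri \<phi>\<close> is exactly false at \<open>w\<close>; otherwise the common value
  of \<open>\<phi>\<close> determines that of \<open>Tri \<phi>\<close>, with both or neither being passed on and a classical value
  giving exactly true. A counter-model to \<open>\<phi> \<turnstile> \<chi>\<close> interprets the root, hence a whole branch, and
  an interpreted branch is not closed.
\<close>

fun val_holds :: "('p, 'w) model \<Rightarrow> 'w \<Rightarrow> 'p fm \<Rightarrow> vlabel \<Rightarrow> bool" where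
  "val_holds M x \<phi> TT \<longleftrightarrow> sat_pos M x \<phi>"
| "val_holds M x \<phi> FF \<longleftrightarrow> sat_neg M x \<phi>"
| "val_holds M x \<phi> NT \<longleftrightarrow> \<not> sat_pos M x \<phi>"
| "val_holds M x \<phi> NF \<longleftrightarrow> \<not> sat_neg M x \<phi>"

lemma val_holds_bar [simp]: "val_holds M x \<phi> (bar v) \<longleftrightarrow> \<not> val_holds M x \<phi> v"
  by (cases v) auto

primrec item_holds :: "('p, 'w) model \<Rightarrow> (state_label \<Rightarrow> 'w) \<Rightarrow> 'p item \<Rightarrow> bool" where
  "item_holds M f (LF w \<phi> v) \<longleftrightarrow> val_holds M (f w) \<phi> v"
| "item_holds M f (Rel w u) \<longleftrightarrow> (f w, f u) \<in> acc M"

definition realises :: "('p, 'w) model \<Rightarrow> (state_label \<Rightarrow> 'w) \<Rightarrow> 'p item set \<Rightarrow> bool" where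
  "realises M f B \<longleftrightarrow> (\<forall>i \<in> B. item_holds M f i)"

lemma realises_Un [simp]: "realises M f (B \<union> C) \<longleftrightarrow> realises M f B \<and> realises M f C"
  by (auto simp: realises_def)

lemma realises_insert [simp]:
  "realises M f (insert i B) \<longleftrightarrow> item_holds M f i \<and> realises M f B"
  by (auto simp: realises_def)

lemma realises_empty [simp]: "realises M f {}"
  by (simp add: realises_def)

lemma realises_mono: "realises M f B \<Longrightarrow> C \<subseteq> B \<Longrightarrow> realises M f C"
  by (auto simp: realises_def)

lemma realises_LF: "LF w \<phi> v \<in> B \<Longrightarrow> realises M f B \<Longrightarrow> val_holds M (f w) \<phi> v"
  by (force simp: realises_def)

lemma item_holds_fun_upd:
  "k \<notin> item_labels i \<Longrightarrow> item_holds M (f(k := x)) i \<longleftrightarrow> item_holds M f i"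
  by (cases i) auto

lemma realises_fun_upd:
  "k \<notin> labels B \<Longrightarrow> realises M (f(k := x)) B \<longleftrightarrow> realises M f B"
  by (auto simp: realises_def labels_def item_holds_fun_upd)

lemma LF_in_labels: "LF w \<phi> v \<in> B \<Longrightarrow> w \<in> labels B"
  by (force simp: labels_def)

text \<open>Non-falsity, read with both witnesses equal to \<open>y\<close>, rules out both values
  at \<open>y\<close>. Truth rules out neither value there and makes all successors agree.\<close>

lemma Tri_exactly_true:
  assumes "sat_pos M x (Tri \<phi>)" "\<not> sat_neg M x (Tri \<phi>)" "(x, y) \<in> acc M"
  shows "sat_neg M y \<phi> \<longleftrightarrow> \<not> sat_pos M y \<phi>"
    and "(x, z) \<in> acc M \<Longrightarrow> sat_pos M z \<phi> \<longleftrightarrow> sat_pos M y \<phi>"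
  using assms unfolding sat_pos.simps sat_neg.simps by blast+

text \<open>If all successors agreed, the last disjunct of falsity would give \<phi> both values at
  every successor, and \<open>Tri \<phi>\<close> would be true as well.\<close>

lemma Tri_exactly_false:
  assumes "sat_neg M x (Tri \<phi>)" "\<not> sat_pos M x (Tri \<phi>)"
  obtains y z where "(x, y) \<in> acc M" "(x, z) \<in> acc M"
    "sat_pos M y \<phi> \<and> \<not> sat_pos M z \<phi> \<or> sat_neg M y \<phi> \<and> \<not> sat_neg M z \<phi>"
  using assms unfolding sat_pos.simps sat_neg.simps by blast

text \<open>Truth makes the successors agree, so falsity can only come from one successor where
  \<phi> is true and one where it is false; agreement spreads both values to all.\<close>

lemma Tri_both:
  assumes "sat_pos M x (Tri \<phi>)" "sat_neg M x (Tri \<phi>)"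
  shows "(x, y) \<in> acc M \<Longrightarrow> sat_pos M y \<phi> \<and> sat_neg M y \<phi>" and "\<exists>y. (x, y) \<in> acc M"
  using assms unfolding sat_pos.simps sat_neg.simps by blast+

text \<open>Non-falsity makes the successors agree, so truth can only fail at a successor with
  neither value, and agreement spreads this to all.\<close>

lemma Tri_neither:
  assumes "\<not> sat_pos M x (Tri \<phi>)" "\<not> sat_neg M x (Tri \<phi>)"
  shows "(x, y) \<in> acc M \<Longrightarrow> \<not> sat_pos M y \<phi> \<and> \<not> sat_neg M y \<phi>" and "\<exists>y. (x, y) \<in> acc M"
  using assms unfolding sat_pos.simps sat_neg.simps by blast+

declare sat_pos.simps(5) [simp del] sat_neg.simps(5) [simp del]

text \<open>The map \<open>vneg (bar v)\<close> swaps \<open>TT\<close> with \<open>NF\<close> and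
  \<open>FF\<close> with \<open>NT\<close>; at a classical value the swapped labels say the
  same.\<close>

lemma val_holds_vneg_bar:
  assumes "sat_neg M y \<phi> \<longleftrightarrow> \<not> sat_pos M y \<phi>"
  shows "val_holds M y \<phi> (vneg (bar v)) \<longleftrightarrow> val_holds M y \<phi> v"
  using assms by (cases v) auto

lemma val_holds_cong:
  assumes "sat_pos M y \<phi> \<longleftrightarrow> sat_pos M z \<phi>" "sat_neg M y \<phi> \<longleftrightarrow> sat_neg M z \<phi>"
  shows "val_holds M y \<phi> v \<longleftrightarrow> val_holds M z \<phi> v"
  using assms by (cases v) auto

text \<open>The interpretation \<open>g\<close> may differ from \<open>f\<close> because fresh
  labels have to be sent to witnesses; freshness keeps the items of \<open>B\<close> true.\<close>

lemma expands_realises: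
  assumes "expands B Cs" "realises M f B"
  shows "\<exists>C \<in> set Cs. \<exists>g. realises M g (B \<union> C)"
  using assms
proof (induction rule: expands.induct)
  case (Tri_T w \<phi> u v B)
  have tri: "sat_pos M (f w) (Tri \<phi>)" "\<not> sat_neg M (f w) (Tri \<phi>)"
    and acc: "(f w, f u) \<in> acc M" and v: "val_holds M (f u) \<phi> v"
    using realises_mono[OF Tri_T.prems Tri_T.hyps] by simp_all
  have "val_holds M (f u) \<phi> (vneg (bar v))"
    using v by (simp only: val_holds_vneg_bar[OF Tri_exactly_true(1)[OF tri acc]])
  with Tri_T.prems show ?case by auto
next
  case (Tri_T' w \<phi> u1 u2 v B)
  have tri: "sat_pos M (f w) (Tri \<phi>)" "\<not> sat_neg M (f w) (Tri \<phi>)"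
    and acc: "(f w, f u1) \<in> acc M" "(f w, f u2) \<in> acc M" and v: "val_holds M (f u1) \<phi> v"
    using realises_mono[OF Tri_T'.prems Tri_T'.hyps] by simp_all
  have "val_holds M (f u2) \<phi> v"
    using v Tri_exactly_true[OF tri acc(1)] Tri_exactly_true(1)[OF tri acc(2)] acc(2)
    \<comment> \<open>Agreement on truth gives agreement on falsity, as \<phi> is classical at both
      successors.\<close>
    by (subst val_holds_cong[where z = "f u1"]) auto
  then have "val_holds M (f u2) \<phi> (vneg (bar v))"
    by (simp only: val_holds_vneg_bar[OF Tri_exactly_true(1)[OF tri acc(2)]])
  with \<open>val_holds M (f u2) \<phi> v\<close> Tri_T'.prems show ?case by auto
next
  case (Tri_F w \<phi> B k1 k2)
  have "sat_neg M (f w) (Tri \<phi>)" "\<not> sat_pos M (f w) (Tri \<phi>)"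
    using realises_mono[OF Tri_F.prems Tri_F.hyps(1)] by simp_all
  then obtain y z where yz: "(f w, y) \<in> acc M" "(f w, z) \<in> acc M"
    "sat_pos M y \<phi> \<and> \<not> sat_pos M z \<phi> \<or> sat_neg M y \<phi> \<and> \<not> sat_neg M z \<phi>"
    by (rule Tri_exactly_false)
  \<comment> \<open>Since \<open>w\<close> occurs on the branch, it differs from the fresh labels,
    and the update leaves \<open>f w\<close> in place for the new relational atoms.\<close>
  have "w \<in> labels B" using Tri_F.hyps(1) by (auto intro: LF_in_labels)
  then have "w \<noteq> k1" "w \<noteq> k2" using Tri_F.hyps by auto
  then show ?case
    using yz Tri_F.hyps Tri_F.prems
    \<comment> \<open>The disjunct that holds of \<open>y\<close> and \<open>z\<close> selects the
      alternative of the split.\<close>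
    by (auto simp: realises_fun_upd intro!: exI[of _ "f(k1 := y, k2 := z)"])
next
  case (Tri_B w \<phi> u B)
  have "sat_pos M (f u) \<phi> \<and> sat_neg M (f u) \<phi>"
    using realises_mono[OF Tri_B.prems Tri_B.hyps] by (intro Tri_both(1)[of M "f w"]) simp_all
  with Tri_B.prems show ?case by auto
next
  case (Tri_B_plus w \<phi> B k)
  have tri: "sat_pos M (f w) (Tri \<phi>)" "sat_neg M (f w) (Tri \<phi>)"
    using realises_mono[OF Tri_B_plus.prems Tri_B_plus.hyps(1)] by simp_all
  obtain y where "(f w, y) \<in> acc M" "sat_pos M y \<phi>" "sat_neg M y \<phi>"
    using Tri_both[OF tri] by blast
  moreover have "w \<noteq> k" using Tri_B_plus.hyps by (auto dest: LF_in_labels)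
  ultimately show ?case
    using Tri_B_plus by (auto simp: realises_fun_upd intro!: exI[of _ "f(k := y)"])
next
  case (Tri_N w \<phi> u B)
  have "\<not> sat_pos M (f u) \<phi> \<and> \<not> sat_neg M (f u) \<phi>"
    using realises_mono[OF Tri_N.prems Tri_N.hyps] by (intro Tri_neither(1)[of M "f w"]) simp_all
  with Tri_N.prems show ?case by auto
next
  case (Tri_N_plus w \<phi> B k)
  have tri: "\<not> sat_pos M (f w) (Tri \<phi>)" "\<not> sat_neg M (f w) (Tri \<phi>)"
    using realises_mono[OF Tri_N_plus.prems Tri_N_plus.hyps(1)] by simp_all
  obtain y where "(f w, y) \<in> acc M" "\<not> sat_pos M y \<phi>" "\<not> sat_neg M y \<phi>"
    using Tri_neither[OF tri] by blast
  moreover have "w \<noteq> k" using Tri_N_plus.hyps by (auto dest: LF_in_labels)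
  ultimately show ?case
    using Tri_N_plus by (auto simp: realises_fun_upd intro!: exI[of _ "f(k := y)"])
next
  \<comment> \<open>Under \<open>f\<close> exactly one of \<open>v\<close> and \<open>bar v\<close>
    holds, by \<open>val_holds_bar\<close>.\<close>
  case (Cut u \<psi> v' B \<phi> w v)
  then show ?case by auto
qed (auto intro!: exI[of _ f] dest!: realises_LF)

text \<open>The induction generalises over \<open>f\<close> as well as \<open>A\<close>, since each
  rule application may reinterpret labels.\<close>

lemma tree_from_realises_branch:
  assumes "tree_from A t" "realises M f (A \<union> root t)"
  shows "\<exists>b \<in> branches t. \<exists>g. realises M g (A \<union> \<Union>(set b))"
  using assms
proof (induction t arbitrary: A f)
  case (Node N ts)
  show ?case
  proof (cases "ts = []")
    case True
    with Node.prems show ?thesis by auto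
  next
    case False
    with Node.prems have "expands (A \<union> N) (map root ts)"
      and sub: "\<And>t. t \<in> set ts \<Longrightarrow> tree_from (A \<union> N) t"
      by auto
    with Node.prems(2) obtain t g
      where t: "t \<in> set ts" and "realises M g (A \<union> N \<union> root t)"
      using expands_realises by fastforce
    with Node.IH sub obtain b h
      where "b \<in> branches t" "realises M h (A \<union> N \<union> \<Union>(set b))"
      by blast
    with t False show ?thesis
      by (auto intro!: bexI[of _ t] exI[of _ h])
  qed
qed

lemma realises_not_closed_branch: "realises M f (\<Union>(set b)) \<Longrightarrow> \<not> closed_branch b"
  unfolding closed_branch_def by (metis realises_LF val_holds_bar)

theorem theorem2:
  fixes \<phi> \<chi> :: "'p::countable fm"
  assumes "proved \<phi> \<chi>"
  shows "valid TYPE('w) \<phi> \<chi>"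
  unfolding valid_def
proof (intro allI impI ballI, rule ccontr)
  fix M :: "('p, 'w) model" and w
  assume "sat_pos M w \<phi>" "\<not> sat_pos M w \<chi>"
  moreover obtain t where t: "tree_from {} t" "root t = {LF 0 \<phi> TT, LF 0 \<chi> NT}" "closed_tree t"
    using assms by (auto simp: proved_def proof_tree_def)
  \<comment> \<open>Only label 0 occurs at the root, so the values at all other labels are
    arbitrary; a label is reassigned when it is introduced as fresh.\<close>
  ultimately have "realises M (\<lambda>_. w) ({} \<union> root t)" by simp
  from tree_from_realises_branch[OF t(1) this] t(3) show False
    by (auto simp: closed_tree_def dest: realises_not_closed_branch)
qed

end
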